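(* Let $S$ be a semigroup and let $\sigma:S\to S$ be an involutive morphism. Let $\mu$ be a complex measure that is a linear combination of Dirac measures $(\delta_{z_i})_{i\in I}$ such that $z_i$ is contained in the center of $S$ for all $i\in I$. The non-zero central solutions $f:S\to\mathbb{C}$ of $$\int_S f(x\sigma(y)t)\,d\mu(t)-\int_S f(xyt)\,d\mu(t)=2f(x)f(y),\quad x,y\in S,$$ are the functions of the form $$f=\frac{\chi-\chi\circ\sigma}{2}\int_S\chi(\sigma(t))\,d\mu(t),$$ where $\chi:S\to\mathbb{C}$ is a multiplicative function such that $\int_S\chi(t)\,d\mu(t)\neq 0$ and $\int_S\chi(\sigma(t))\,d\mu(t)=-\int_S\chi(t)\,d\mu(t)$. Furthermore, if $S$ is a topological semigroup and $\sigma:S\to S$ is continuous, then the non-zero solution $f$ is continuous if and only if $\chi$ is continuous.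
   Context: A semigroup is a set with an associative operation, written multiplicatively. An involutive morphism of $S$ is a map $\sigma:S\to S$ with $\sigma(\sigma(x))=x$ for all $x\in S$ that is either an automorphism ($\sigma(xy)=\sigma(x)\sigma(y)$ for all $x,y\in S$) or an anti-automorphism ($\sigma(xy)=\sigma(y)\sigma(x)$ for all $x,y\in S$). The measure is $\mu=\sum_{i\in I}\alpha_i\delta_{z_i}$ (finite linear combination, $\alpha_i\in\mathbb{C}$), so $\int_S h(t)\,d\mu(t)=\sum_i\alpha_i h(z_i)$. A function $\chi:S\to\mathbb{C}$ is multiplicative if $\chi(xy)=\chi(x)\chi(y)$ for all $x,y\in S$. A function $f$ on $S$ is central if $f(xy)=f(yx)$ for all $x,y\in S$. *)

theory Defs
  imports "HOL-Analysis.Analysis"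
begin

definition involutive_morphism :: "('a::semigroup_mult \<Rightarrow> 'a) \<Rightarrow> bool" where
  "involutive_morphism \<sigma> \<longleftrightarrow>
     (\<forall>x. \<sigma> (\<sigma> x) = x) \<and>
     ((\<forall>x y. \<sigma> (x * y) = \<sigma> x * \<sigma> y) \<or> (\<forall>x y. \<sigma> (x * y) = \<sigma> y * \<sigma> x))"

definition semigroup_center :: "'a::semigroup_mult set" where
  "semigroup_center = {c. \<forall>x. c * x = x * c}"

definition multiplicative_fun :: "('a::semigroup_mult \<Rightarrow> complex) \<Rightarrow> bool" where
  "multiplicative_fun chi \<longleftrightarrow> (\<forall>x y. chi (x * y) = chi x * chi y)"

definition central_fun :: "('a::semigroup_mult \<Rightarrow> complex) \<Rightarrow> bool" where
  "central_fun f \<longleftrightarrow> (\<forall>x y. f (x * y) = f (y * x))"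

text \<open>The measure is the linear combination, with coefficients \<open>\<alpha> i\<close>, of the Dirac measures at
  the points \<open>z i\<close> for \<open>i \<in> I\<close>. It is represented by the triple \<open>I\<close>, \<open>\<alpha>\<close>, \<open>z\<close>, since the library
  has no complex measures. The points need not be distinct.\<close>

definition dirac_comb_integral ::
  "'i set \<Rightarrow> ('i \<Rightarrow> complex) \<Rightarrow> ('i \<Rightarrow> 'a) \<Rightarrow> ('a \<Rightarrow> complex) \<Rightarrow> complex" where
  "dirac_comb_integral I \<alpha> z h = (\<Sum>i\<in>I. \<alpha> i * h (z i))"

text \<open>The topology is a value and not a class instance, so that a semigroup without
  topology and its possible topologies can occur in the same statement. No separation axiom is
  imposed.\<close>

definition topological_semigroup :: "'a::semigroup_mult topology \<Rightarrow> bool" where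
  "topological_semigroup T \<longleftrightarrow>
     topspace T = UNIV \<and> continuous_map (prod_topology T T) T (\<lambda>(x, y). x * y)"

end

theory Submission
  imports Defs
begin

text \<open>Let \<open>g x = \<integral> f (x t) d\<mu>(t)\<close>. Replacing \<open>y\<close> by \<open>\<sigma> y\<close> in the equation shows that
  \<open>f\<close> is odd under \<open>\<sigma>\<close>, and integrating the equation once more over \<open>\<mu>\<close>, in either variable,
  shows that \<open>g\<close> is even. Splitting the twice integrated function into its even and odd parts
  gives \<open>k (f (x y) - f (x \<sigma>(y))) = 2 g x f y\<close> with \<open>k = \<integral> f d\<mu>\<close>, so \<open>k \<noteq> 0\<close>, and
  \<open>f\<close> satisfies the sine addition law with companion \<open>G = g / k\<close>. Then
  \<open>G (x y) = G x G y - f x f y / k\<close>, so \<open>\<chi> = G + d f\<close> is multiplicative when \<open>d\<^sup>2 = - 1 / k\<close>,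
  and \<open>\<chi> \<circ> \<sigma> = G - d f\<close>. For continuity, \<open>f\<close> and \<open>g\<close> are non-zero multiples of
  \<open>\<chi> - \<chi> \<circ> \<sigma>\<close> and \<open>\<chi> + \<chi> \<circ> \<sigma>\<close>.\<close>

section \<open>Morphisms, central functions and Dirac combinations\<close>

lemma involutive_morphism_idem:
  "involutive_morphism \<sigma> \<Longrightarrow> \<sigma> (\<sigma> x) = x"
  by (simp add: involutive_morphism_def)

lemma central_fun_commute: "central_fun h \<Longrightarrow> h (x * y) = h (y * x)"
  by (simp add: central_fun_def)

text \<open>Centrality of \<open>h\<close> hides the order of the factors, so automorphisms and
  anti-automorphisms can be treated alike from here on.\<close>

lemma central_fun_involutive_morphism:
  "involutive_morphism \<sigma> \<Longrightarrow> central_fun h \<Longrightarrow> h (\<sigma> (x * y)) = h (\<sigma> x * \<sigma> y)"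
  by (auto simp: involutive_morphism_def central_fun_def)

lemma multiplicative_fun_involutive_morphism:
  "involutive_morphism \<sigma> \<Longrightarrow> multiplicative_fun chi \<Longrightarrow> multiplicative_fun (\<lambda>x. chi (\<sigma> x))"
  by (auto simp: involutive_morphism_def multiplicative_fun_def mult.commute)

lemma dirac_comb_integral_diff:
  "dirac_comb_integral I \<alpha> z (\<lambda>t. h t - k t) = dirac_comb_integral I \<alpha> z h - dirac_comb_integral I \<alpha> z k"
  by (simp add: dirac_comb_integral_def sum_subtractf algebra_simps)

lemma dirac_comb_integral_cmult:
  "dirac_comb_integral I \<alpha> z (\<lambda>t. c * h t) = c * dirac_comb_integral I \<alpha> z h"
  by (simp add: dirac_comb_integral_def sum_distrib_left mult.left_commute)

lemma dirac_comb_integral_cmult_right: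
  "dirac_comb_integral I \<alpha> z (\<lambda>t. h t * c) = dirac_comb_integral I \<alpha> z h * c"
  by (simp add: dirac_comb_integral_def sum_distrib_right mult.assoc)

lemma dirac_comb_integral_cong:
  "(\<And>i. i \<in> I \<Longrightarrow> h (z i) = k (z i)) \<Longrightarrow> dirac_comb_integral I \<alpha> z h = dirac_comb_integral I \<alpha> z k"
  by (simp add: dirac_comb_integral_def)

lemma central_fun_dirac_comb_integral:
  assumes "\<forall>i\<in>I. z i \<in> semigroup_center" and "central_fun h"
  shows "central_fun (\<lambda>x. dirac_comb_integral I \<alpha> z (\<lambda>t. h (x * t)))"
  unfolding central_fun_def
proof (intro allI dirac_comb_integral_cong)
  fix x y i
  assume "i \<in> I"
  with assms(1) have "y * z i = z i * y"
    by (simp add: semigroup_center_def)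
  then show "h (x * y * z i) = h (y * x * z i)"
    using central_fun_commute[OF assms(2), of x "y * z i"]
      central_fun_commute[OF assms(2), of "z i" "y * x"]
    by (simp add: mult.assoc)
qed

text \<open>Associativity makes the defect \<open>G (x * y) - G x * G y\<close> a product
  \<open>f x * h y\<close>. The defect is symmetric because \<open>G\<close> is central, so
  \<open>h\<close> is a multiple of \<open>f\<close>.\<close>

lemma sine_addition_companion:
  fixes f G :: "'a::semigroup_mult \<Rightarrow> complex"
  assumes add: "\<And>x y. f (x * y) = f x * G y + G x * f y"
    and "central_fun G" and "f \<noteq> (\<lambda>x. 0)"
  obtains c where "\<And>x y. G (x * y) = G x * G y + c * f x * f y"
proof -
  obtain a where a: "f a \<noteq> 0"
    using assms(3) by blast
  \<comment> \<open>Expand \<open>f (x * y * w)\<close> by \<open>add\<close> along both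
    bracketings; the terms with no value of \<open>G\<close> at a product cancel.\<close>
  have assoc: "f w * (G (x * y) - G x * G y) = f x * (G (y * w) - G y * G w)" for x y w
  proof -
    have "f (x * y * w) = f (x * (y * w))"
      by (simp add: mult.assoc)
    then show ?thesis
      unfolding add by algebra
  qed
  define h where "h y = (G (y * a) - G y * G a) / f a" for y
  have h: "G (x * y) - G x * G y = f x * h y" for x y
    unfolding h_def times_divide_eq_right nonzero_eq_divide_eq[OF a]
    using assoc[of a x y] by algebra
  have swap: "f x * h y = f y * h x" for x y
    using h[of x y] h[of y x] central_fun_commute[OF assms(2), of x y] by algebra
  have h_eq: "h y = h a / f a * f y" for y
    unfolding times_divide_eq_left nonzero_eq_divide_eq[OF a]
    using swap[of a y] by algebra
  have "G (x * y) = G x * G y + h a / f a * f x * f y" for x y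
    using h[of x y] unfolding h_eq[of y] by (simp add: diff_eq_eq mult_ac)
  then show thesis
    by (rule that)
qed

section \<open>From a solution to a multiplicative function\<close>

locale sine_subtraction_solution =
  fixes \<sigma> :: "'a::semigroup_mult \<Rightarrow> 'a"
    and I :: "'i set" and \<alpha> :: "'i \<Rightarrow> complex" and z :: "'i \<Rightarrow> 'a"
    and f :: "'a \<Rightarrow> complex"
  assumes invol: "involutive_morphism \<sigma>"
    and center: "\<forall>i\<in>I. z i \<in> semigroup_center"
    and nonzero: "f \<noteq> (\<lambda>x. 0)"
    and central: "central_fun f"
    and equation: "dirac_comb_integral I \<alpha> z (\<lambda>t. f (x * \<sigma> y * t))
               - dirac_comb_integral I \<alpha> z (\<lambda>t. f (x * y * t)) = 2 * f x * f y"
begin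

abbreviation "integ \<equiv> dirac_comb_integral I \<alpha> z"

definition "g x = integ (\<lambda>t. f (x * t))"

definition "g2 x = integ (\<lambda>t. g (x * t))"

lemmas idem = involutive_morphism_idem[OF invol]
lemmas sigma_mult = central_fun_involutive_morphism[OF invol]

lemma central_g: "central_fun g"
  using central_fun_dirac_comb_integral[OF center central] unfolding g_def[abs_def] .

lemma central_g2: "central_fun g2"
  using central_fun_dirac_comb_integral[OF center central_g] unfolding g2_def[abs_def] .

lemma g_eq: "g (x * \<sigma> y) - g (x * y) = 2 * f x * f y"
  using equation by (simp add: g_def)

lemma g_nonzero: obtains a where "g a \<noteq> 0"
proof -
  obtain a where "f a \<noteq> 0"
    using nonzero by blast
  then have "g (a * \<sigma> a) \<noteq> 0 \<or> g (a * a) \<noteq> 0"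
    using g_eq[of a a] by auto
  then show thesis
    using that by blast
qed

lemma f_odd: "f (\<sigma> y) = - f y"
proof -
  obtain a where a: "f a \<noteq> 0"
    using nonzero by blast
  have "2 * f a * f (\<sigma> y) = - (2 * f a * f y)"
    unfolding g_eq[symmetric] by (simp add: idem)
  with a show ?thesis
    by (metis mult_cancel_left mult_eq_0_iff mult_minus_right zero_neq_numeral)
qed

text \<open>The right side of \<open>g_eq\<close> is symmetric in \<open>x\<close> and
  \<open>y\<close>, and so is \<open>g (x * y)\<close>; hence \<open>g (x * \<sigma> y)\<close> is
  symmetric too.\<close>

lemma g_swap: "g (x * \<sigma> y) = g (\<sigma> x * y)"
  using g_eq[of x y] g_eq[of y x] central_fun_commute[OF central_g, of x y]
    central_fun_commute[OF central_g, of "\<sigma> x" y] by (simp add: algebra_simps)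

text \<open>Covers only elements that are products; \<open>g_even\<close> extends it to all of the
  semigroup.\<close>

lemma g_even_on_products: "g (\<sigma> (x * y)) = g (x * y)"
  using sigma_mult[OF central_g, of x y] g_swap[of "\<sigma> x" y] by (simp add: idem)

text \<open>The points \<open>z i\<close> commute with \<open>y\<close>, so this is
  \<open>g_eq\<close> at \<open>x * t\<close>, integrated over \<open>t\<close>.\<close>

lemma g2_eq_left: "g2 (x * \<sigma> y) - g2 (x * y) = 2 * g x * f y"
proof -
  have "g2 (x * y') = integ (\<lambda>t. g (x * t * y'))" for y'
    unfolding g2_def
    by (rule dirac_comb_integral_cong) (use center in \<open>auto simp: semigroup_center_def mult.assoc\<close>)
  then have "g2 (x * \<sigma> y) - g2 (x * y) = integ (\<lambda>t. 2 * f (x * t) * f y)"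
    by (simp add: g_eq flip: dirac_comb_integral_diff)
  then show ?thesis
    by (simp add: dirac_comb_integral_cmult dirac_comb_integral_cmult_right g_def)
qed

lemma g2_eq_right: "g2 (\<sigma> x * y) - g2 (x * y) = 2 * f x * g y"
  using g2_eq_left[of y x] central_fun_commute[OF central_g2, of y]
  by simp

text \<open>If \<open>f\<close> vanished on all products, \<open>g\<close> would be zero. Such a
  product is where \<open>g_even\<close> divides by \<open>f\<close>.\<close>

lemma f_nonzero_on_products: obtains a b where "f (a * b) \<noteq> 0"
proof -
  obtain a where a: "g a \<noteq> 0"
    by (rule g_nonzero)
  have "\<exists>b. f (a * b) \<noteq> 0"
  proof (rule ccontr)
    assume "\<nexists>b. f (a * b) \<noteq> 0"
    then have "g a = 0"
      by (simp add: g_def dirac_comb_integral_def)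
    with a show False ..
  qed
  then show thesis
    using that by blast
qed

text \<open>The odd part of \<open>g\<close> is proportional to \<open>f\<close>, yet vanishes at a
  product where \<open>f\<close> does not.\<close>

lemma g_even: "g (\<sigma> x) = g x"
proof -
  have *: "g2 (\<sigma> x * \<sigma> y) - g2 (x * y) = 2 * f x * g y + 2 * g (\<sigma> x) * f y" for x y
    using g2_eq_left[of "\<sigma> x" y] g2_eq_right[of x y] by (simp add: algebra_simps)
  \<comment> \<open>The left side of \<open>*\<close> is symmetric in \<open>x\<close> and
    \<open>y\<close> because \<open>g2\<close> is central, so the right side is symmetric as
    well.\<close>
  have proportional: "f y * (g x - g (\<sigma> x)) = f x * (g y - g (\<sigma> y))" for x y
    using *[of x y] *[of y x] central_fun_commute[OF central_g2, of x y]
      central_fun_commute[OF central_g2, of "\<sigma> x" "\<sigma> y"] by algebra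
  obtain a b where "f (a * b) \<noteq> 0"
    by (rule f_nonzero_on_products)
  then show ?thesis
    using proportional[of "a * b" x] by (simp add: g_even_on_products)
qed

text \<open>Moving \<sigma> from \<open>x\<close> to \<open>t\<close> by \<open>g_swap\<close> turns
  the integrand into that of \<open>g_eq\<close>. Thus the odd part of \<open>g2\<close> is
  \<open>- f x * integ f\<close>.\<close>

lemma g2_sigma: "g2 (\<sigma> x) = g2 x + 2 * f x * integ f"
proof -
  have "g2 (\<sigma> x) - g2 x = integ (\<lambda>t. 2 * f x * f t)"
    unfolding g2_def by (simp add: g_eq flip: g_swap dirac_comb_integral_diff)
  then show ?thesis
    unfolding dirac_comb_integral_cmult by (simp add: diff_eq_eq add.commute)
qed

text \<open>Adding \<open>g2_eq_left\<close> at \<open>x\<close> and at \<open>\<sigma> x\<close>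
  cancels the even part of \<open>g2\<close>; \<open>g2_sigma\<close> expresses the odd part through
  \<open>f\<close>.\<close>

lemma f_diff: "integ f * (f (x * y) - f (x * \<sigma> y)) = 2 * g x * f y"
proof -
  have "g2 (\<sigma> x * y) = g2 (\<sigma> (x * \<sigma> y))"
    using sigma_mult[OF central_g2] by (simp add: idem)
  moreover have "g2 (\<sigma> x * \<sigma> y) = g2 (\<sigma> (x * y))"
    using sigma_mult[OF central_g2] by simp
  ultimately show ?thesis
    using g2_eq_left[of x y] g2_eq_left[of "\<sigma> x" y] g2_sigma[of "x * y"] g2_sigma[of "x * \<sigma> y"]
    unfolding g_even by algebra
qed

lemma integ_nonzero: "integ f \<noteq> 0"
proof
  assume "integ f = 0"
  moreover obtain a where "g a \<noteq> 0"
    by (rule g_nonzero)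
  ultimately have "f y = 0" for y
    using f_diff[of a y] by simp
  then show False
    using nonzero by blast
qed

definition "G x = g x / integ f"

lemma sine_addition: "f (x * y) = f x * G y + G x * f y"
proof -
  have diff: "f (x * y) - f (x * \<sigma> y) = 2 * G x * f y" for x y
    using f_diff[of x y] integ_nonzero by (simp add: G_def field_simps)
  \<comment> \<open>With this sign the mixed terms cancel in the sum of \<open>diff\<close> at
    \<open>(x, y)\<close> and at \<open>(y, x)\<close>.\<close>
  have "f (y * \<sigma> x) = - f (x * \<sigma> y)"
    using f_odd[of "x * \<sigma> y"] sigma_mult[OF central, of x "\<sigma> y"]
      central_fun_commute[OF central, of "\<sigma> x" y] by (simp add: idem)
  then have "2 * f (x * y) = 2 * (f x * G y + G x * f y)"
    using diff[of x y] diff[of y x] central_fun_commute[OF central, of y x]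
    by algebra
  then show ?thesis
    by (subst (asm) mult_left_cancel) simp_all
qed

lemma G_mult: "G (x * y) = G x * G y - f x * f y / integ f"
proof -
  have "central_fun G"
    using central_g by (simp add: G_def central_fun_def)
  then obtain c where c: "\<And>x y. G (x * y) = G x * G y + c * f x * f y"
    by (rule sine_addition_companion[OF sine_addition _ nonzero]) (rule that)
  obtain a where a: "f a \<noteq> 0"
    using nonzero by blast
  \<comment> \<open>The constant \<open>c\<close> is found by computing this difference twice: from
    \<open>g_eq\<close>, and from \<open>c\<close> with \<open>f\<close> odd and \<open>G\<close>
    even.\<close>
  have "G (a * \<sigma> a) - G (a * a) = 2 * f a * f a / integ f"
    using g_eq[of a a] by (simp add: G_def flip: diff_divide_distrib)
  moreover have "G (a * \<sigma> a) - G (a * a) = - 2 * c * f a * f a"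
    using c[of a a] c[of a "\<sigma> a"] by (simp add: f_odd G_def g_even)
  ultimately have "(2 * f a * f a) * (- c) = (2 * f a * f a) * (1 / integ f)"
    by (simp add: mult_ac)
  then have "- c = 1 / integ f"
    using a by (subst (asm) mult_left_cancel) simp_all
  then have "c = - 1 / integ f"
    by (metis minus_divide_left minus_minus)
  with c show ?thesis
    by simp
qed

lemma multiplicative_representation:
  obtains chi where "multiplicative_fun chi" and "integ chi \<noteq> 0"
    and "integ (\<lambda>t. chi (\<sigma> t)) = - integ chi"
    and "f = (\<lambda>x. (chi x - chi (\<sigma> x)) / 2 * integ (\<lambda>t. chi (\<sigma> t)))"
proof -
  \<comment> \<open>With this \<open>d\<close> the defect \<open>- f x * f y / integ f\<close> of
    \<open>G\<close> equals \<open>d\<^sup>2 * f x * f y\<close>, as multiplicativity of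
    \<open>G + d f\<close> demands.\<close>
  define d where "d = csqrt (- 1 / integ f)"
  have "d\<^sup>2 = - 1 / integ f"
    by (simp add: d_def)
  then have k: "integ f = - 1 / d\<^sup>2" and d: "d \<noteq> 0"
    using integ_nonzero by auto
  define chi where "chi x = G x + d * f x" for x
  have mult: "multiplicative_fun chi"
    unfolding multiplicative_fun_def chi_def
    using d by (simp add: sine_addition G_mult k field_simps power2_eq_square)
  have chi_sigma: "chi (\<sigma> x) = G x - d * f x" for x
    by (simp add: chi_def f_odd G_def g_even)
  have f: "f x = (chi x - chi (\<sigma> x)) / (2 * d)" for x
    using d unfolding chi_sigma by (simp add: chi_def)
  \<comment> \<open>Two linear relations determine both integrals:
    \<open>n - n' = 2 * d * integ f\<close>, and the expansion of \<open>g\<close> through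
    \<open>chi\<close> in \<open>rel\<close>.\<close>
  define n where "n = integ chi"
  define n' where "n' = integ (\<lambda>t. chi (\<sigma> t))"
  have "n - n' = integ (\<lambda>t. 2 * d * f t)"
    unfolding n_def n'_def dirac_comb_integral_diff[symmetric]
    using d by (simp add: f)
  then have diff: "n' = n + 2 * (1 / d)"
    unfolding dirac_comb_integral_cmult k
    using d by (simp add: diff_eq_eq power2_eq_square)
  have rel: "2 * d * g x = chi x * n - chi (\<sigma> x) * n'" for x
  proof -
    have "2 * d * g x = integ (\<lambda>t. chi x * chi t - chi (\<sigma> x) * chi (\<sigma> t))"
      unfolding g_def dirac_comb_integral_cmult[symmetric]
      using d mult multiplicative_fun_involutive_morphism[OF invol mult]
      by (simp add: f multiplicative_fun_def)
    then show ?thesis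
      by (simp add: dirac_comb_integral_diff dirac_comb_integral_cmult n_def n'_def)
  qed
  obtain a where a: "f a \<noteq> 0"
    using nonzero by blast
  \<comment> \<open>Since \<open>g = integ f * G\<close>, the value \<open>g a\<close> is also a
    multiple of \<open>chi a + chi (\<sigma> a)\<close>; comparison with \<open>rel\<close> leaves a
    multiple of \<open>f a\<close>, which can be cancelled.\<close>
  have "g a = - G a / d\<^sup>2"
    using d by (simp add: G_def k)
  then have "2 * d * g a = - (2 * G a) * (1 / d)"
    using d by (simp add: power2_eq_square)
  also have "2 * G a = chi a + chi (\<sigma> a)"
    unfolding chi_sigma by (simp add: chi_def)
  finally have "(n + 1 / d) * (chi a - chi (\<sigma> a)) = 0"
    using rel[of a] diff by algebra
  then have n: "n = - 1 / d"
    using a f[of a] by (simp add: eq_neg_iff_add_eq_0)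
  then have n': "n' = 1 / d"
    using diff by (simp add: field_simps)
  show thesis
  proof (rule that[OF mult])
    show "integ chi \<noteq> 0"
      using n d by (simp add: n_def)
    show "integ (\<lambda>t. chi (\<sigma> t)) = - integ chi"
      using n n' by (simp add: n_def n'_def)
    show "f = (\<lambda>x. (chi x - chi (\<sigma> x)) / 2 * integ (\<lambda>t. chi (\<sigma> t)))"
      using n' by (simp add: fun_eq_iff f flip: n'_def)
  qed
qed

end

section \<open>From a multiplicative function to a solution\<close>

text \<open>Multiplicativity takes \<open>x\<close> out of the integral, and the opposite signs of
  the two integrals turn the difference into a sum. Used both for the equation and for
  continuity.\<close>

lemma multiplicative_integral_translate:
  assumes "involutive_morphism \<sigma>" and "multiplicative_fun chi"
    and "dirac_comb_integral I \<alpha> z (\<lambda>t. chi (\<sigma> t)) = - dirac_comb_integral I \<alpha> z chi"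
  shows "dirac_comb_integral I \<alpha> z (\<lambda>t. (chi (x * t) - chi (\<sigma> (x * t))) / 2 * c)
    = (chi x + chi (\<sigma> x)) / 2 * dirac_comb_integral I \<alpha> z chi * c"
proof -
  have "dirac_comb_integral I \<alpha> z (\<lambda>t. (chi (x * t) - chi (\<sigma> (x * t))) / 2 * c)
    = dirac_comb_integral I \<alpha> z (\<lambda>t. c / 2 * (chi x * chi t - chi (\<sigma> x) * chi (\<sigma> t)))"
    using assms(2) multiplicative_fun_involutive_morphism[OF assms(1,2)]
    by (simp add: multiplicative_fun_def mult.commute)
  also have "\<dots> = (chi x + chi (\<sigma> x)) / 2 * dirac_comb_integral I \<alpha> z chi * c"
    unfolding dirac_comb_integral_cmult dirac_comb_integral_diff assms(3)
    by (simp add: algebra_simps)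
  finally show ?thesis .
qed

lemma multiplicative_solution:
  assumes "involutive_morphism \<sigma>" and "multiplicative_fun chi"
    and "dirac_comb_integral I \<alpha> z chi \<noteq> 0"
    and "dirac_comb_integral I \<alpha> z (\<lambda>t. chi (\<sigma> t)) = - dirac_comb_integral I \<alpha> z chi"
    and f_def: "f = (\<lambda>x. (chi x - chi (\<sigma> x)) / 2 * dirac_comb_integral I \<alpha> z (\<lambda>t. chi (\<sigma> t)))"
  shows "f \<noteq> (\<lambda>x. 0)" and "central_fun f"
    and "dirac_comb_integral I \<alpha> z (\<lambda>t. f (x * \<sigma> y * t))
      - dirac_comb_integral I \<alpha> z (\<lambda>t. f (x * y * t)) = 2 * f x * f y"
proof -
  note chi = assms(2)[unfolded multiplicative_fun_def, rule_format]
    multiplicative_fun_involutive_morphism[OF assms(1,2), unfolded multiplicative_fun_def, rule_format]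
  show "f \<noteq> (\<lambda>x. 0)"
  proof
    assume "f = (\<lambda>x. 0)"
    \<comment> \<open>Then the two integrals agree, but they are also opposite, so both would be
      zero.\<close>
    then have "chi (\<sigma> x) = chi x" for x
      using fun_cong[OF f_def, of x] assms(3,4) by simp
    then show False
      using assms(3,4) by simp
  qed
  show "central_fun f"
    by (simp add: f_def central_fun_def chi mult.commute)
  show "dirac_comb_integral I \<alpha> z (\<lambda>t. f (x * \<sigma> y * t))
      - dirac_comb_integral I \<alpha> z (\<lambda>t. f (x * y * t)) = 2 * f x * f y"
    unfolding f_def multiplicative_integral_translate[OF assms(1,2,4)] assms(4)
    by (simp add: chi involutive_morphism_idem[OF assms(1)] field_simps)
qed

section \<open>Continuity\<close>

lemma continuous_map_mult_right:
  assumes "topological_semigroup T"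
  shows "continuous_map T T (\<lambda>x. x * a)"
proof -
  have "continuous_map T (prod_topology T T) (\<lambda>x. (x, a))"
    using assms by (intro continuous_map_pairedI) (auto simp: topological_semigroup_def)
  from continuous_map_compose[OF this, of T "\<lambda>(x, y). x * y"] assms show ?thesis
    by (simp add: topological_semigroup_def comp_def)
qed

lemma continuous_map_complex_mult:
  fixes f g :: "'a \<Rightarrow> complex"
  shows "continuous_map X euclidean f \<Longrightarrow> continuous_map X euclidean g
    \<Longrightarrow> continuous_map X euclidean (\<lambda>x. f x * g x)"
  by (simp add: continuous_map_atin tendsto_mult)

lemma continuous_multiplicative_iff:
  fixes f :: "'a::semigroup_mult \<Rightarrow> complex"
  assumes "involutive_morphism \<sigma>" and "finite I"
    and "topological_semigroup T" and \<sigma>: "continuous_map T T \<sigma>"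
    and "multiplicative_fun chi" and nz: "dirac_comb_integral I \<alpha> z chi \<noteq> 0"
    and odd: "dirac_comb_integral I \<alpha> z (\<lambda>t. chi (\<sigma> t)) = - dirac_comb_integral I \<alpha> z chi"
    and f_def: "f = (\<lambda>x. (chi x - chi (\<sigma> x)) / 2 * dirac_comb_integral I \<alpha> z (\<lambda>t. chi (\<sigma> t)))"
  shows "continuous_map T euclidean f \<longleftrightarrow> continuous_map T euclidean chi"
proof
  assume "continuous_map T euclidean chi"
  moreover from continuous_map_compose[OF \<sigma> this]
  have "continuous_map T euclidean (\<lambda>x. chi (\<sigma> x))"
    by (simp add: comp_def)
  ultimately show "continuous_map T euclidean f"
    unfolding f_def divide_inverse
    by (intro continuous_map_complex_mult continuous_map_diff continuous_map_const[THEN iffD2]) auto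
next
  define m where "m = dirac_comb_integral I \<alpha> z chi"
  assume f: "continuous_map T euclidean f"
  define g where "g x = dirac_comb_integral I \<alpha> z (\<lambda>t. f (x * t))" for x
  have "continuous_map T euclidean (\<lambda>x. f (x * z i))" for i
    using continuous_map_compose[OF continuous_map_mult_right[OF assms(3)] f]
    by (simp add: comp_def)
  then have g: "continuous_map T euclidean g"
    unfolding g_def dirac_comb_integral_def
    by (intro continuous_map_sum continuous_map_complex_mult continuous_map_const[THEN iffD2] assms(2)) auto
  have "g x = (chi x + chi (\<sigma> x)) / 2 * m * (- m)" for x
    unfolding g_def f_def multiplicative_integral_translate[OF assms(1,5) odd] odd m_def ..
  \<comment> \<open>The two summands are the odd and the even part of \<open>chi\<close> under
    \<sigma>.\<close>
  then have "chi = (\<lambda>x. (- 1 / m) * f x + (- 1 / m\<^sup>2) * g x)"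
    using nz unfolding f_def odd by (auto simp: m_def field_simps power2_eq_square)
  moreover have "continuous_map T euclidean (\<lambda>x. (- 1 / m) * f x + (- 1 / m\<^sup>2) * g x)"
    by (intro continuous_map_add continuous_map_complex_mult continuous_map_const[THEN iffD2] f g) auto
  ultimately show "continuous_map T euclidean chi"
    by simp
qed

theorem theorem4p3:
  fixes \<sigma> :: "'a::semigroup_mult \<Rightarrow> 'a"
    and I :: "'i set" and \<alpha> :: "'i \<Rightarrow> complex" and z :: "'i \<Rightarrow> 'a"
  assumes "involutive_morphism \<sigma>"
    and "finite I"
    and "\<forall>i\<in>I. z i \<in> semigroup_center"
  shows
    "(\<forall>f :: 'a \<Rightarrow> complex.
        (f \<noteq> (\<lambda>x. 0) \<and> central_fun f \<and>
         (\<forall>x y. dirac_comb_integral I \<alpha> z (\<lambda>t. f (x * \<sigma> y * t))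
               - dirac_comb_integral I \<alpha> z (\<lambda>t. f (x * y * t)) = 2 * f x * f y))
        \<longleftrightarrow>
        (\<exists>chi :: 'a \<Rightarrow> complex. multiplicative_fun chi \<and>
           dirac_comb_integral I \<alpha> z chi \<noteq> 0 \<and>
           dirac_comb_integral I \<alpha> z (\<lambda>t. chi (\<sigma> t)) = - dirac_comb_integral I \<alpha> z chi \<and>
           f = (\<lambda>x. (chi x - chi (\<sigma> x)) / 2 * dirac_comb_integral I \<alpha> z (\<lambda>t. chi (\<sigma> t)))))
     \<and>
     (\<forall>T :: 'a topology. topological_semigroup T \<and> continuous_map T T \<sigma> \<longrightarrow>
        (\<forall>f chi :: 'a \<Rightarrow> complex. multiplicative_fun chi \<and>
           dirac_comb_integral I \<alpha> z chi \<noteq> 0 \<and>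
           dirac_comb_integral I \<alpha> z (\<lambda>t. chi (\<sigma> t)) = - dirac_comb_integral I \<alpha> z chi \<and>
           f = (\<lambda>x. (chi x - chi (\<sigma> x)) / 2 * dirac_comb_integral I \<alpha> z (\<lambda>t. chi (\<sigma> t)))
           \<longrightarrow> (continuous_map T euclidean f \<longleftrightarrow> continuous_map T euclidean chi)))"
proof (intro conjI allI impI iffI)
  fix f :: "'a \<Rightarrow> complex"
  assume "f \<noteq> (\<lambda>x. 0) \<and> central_fun f \<and>
         (\<forall>x y. dirac_comb_integral I \<alpha> z (\<lambda>t. f (x * \<sigma> y * t))
               - dirac_comb_integral I \<alpha> z (\<lambda>t. f (x * y * t)) = 2 * f x * f y)"
  then interpret sine_subtraction_solution \<sigma> I \<alpha> z f
    using assms by unfold_locales auto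
  show "\<exists>chi. multiplicative_fun chi \<and> integ chi \<noteq> 0 \<and>
      integ (\<lambda>t. chi (\<sigma> t)) = - integ chi \<and>
      f = (\<lambda>x. (chi x - chi (\<sigma> x)) / 2 * integ (\<lambda>t. chi (\<sigma> t)))"
    by (rule multiplicative_representation) (intro exI conjI)
next
  fix f :: "'a \<Rightarrow> complex" and x y
  assume "\<exists>chi. multiplicative_fun chi \<and>
      dirac_comb_integral I \<alpha> z chi \<noteq> 0 \<and>
      dirac_comb_integral I \<alpha> z (\<lambda>t. chi (\<sigma> t)) = - dirac_comb_integral I \<alpha> z chi \<and>
      f = (\<lambda>x. (chi x - chi (\<sigma> x)) / 2 * dirac_comb_integral I \<alpha> z (\<lambda>t. chi (\<sigma> t)))"
  then obtain chi where "multiplicative_fun chi"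
    and "dirac_comb_integral I \<alpha> z chi \<noteq> 0"
    and "dirac_comb_integral I \<alpha> z (\<lambda>t. chi (\<sigma> t)) = - dirac_comb_integral I \<alpha> z chi"
    and "f = (\<lambda>x. (chi x - chi (\<sigma> x)) / 2 * dirac_comb_integral I \<alpha> z (\<lambda>t. chi (\<sigma> t)))"
    by (elim exE conjE)
  note solution = multiplicative_solution[OF assms(1) this]
  show "f \<noteq> (\<lambda>x. 0)" and "central_fun f"
    by (fact solution)+
  show "dirac_comb_integral I \<alpha> z (\<lambda>t. f (x * \<sigma> y * t))
      - dirac_comb_integral I \<alpha> z (\<lambda>t. f (x * y * t)) = 2 * f x * f y"
    by (fact solution)
next
  fix T :: "'a topology" and f chi :: "'a \<Rightarrow> complex"
  assume "topological_semigroup T \<and> continuous_map T T \<sigma>"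
    and "multiplicative_fun chi \<and>
      dirac_comb_integral I \<alpha> z chi \<noteq> 0 \<and>
      dirac_comb_integral I \<alpha> z (\<lambda>t. chi (\<sigma> t)) = - dirac_comb_integral I \<alpha> z chi \<and>
      f = (\<lambda>x. (chi x - chi (\<sigma> x)) / 2 * dirac_comb_integral I \<alpha> z (\<lambda>t. chi (\<sigma> t)))"
  then have "continuous_map T euclidean f \<longleftrightarrow> continuous_map T euclidean chi"
    by (elim conjE) (rule continuous_multiplicative_iff[OF assms(1,2)])
  then show "continuous_map T euclidean f \<Longrightarrow> continuous_map T euclidean chi"
    and "continuous_map T euclidean chi \<Longrightarrow> continuous_map T euclidean f"
    by simp_all
qed

end
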